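(* Let $H$ be a bipartite graph with $v$ vertices and $e$ edges, where $v\le e$. If $H$ satisfies the operator-norm Sidorenko certificate, then, for every graph $G$ with $M(G)=2e(G)>0$, $$\hom(H,G)\ge \lambda(G)^{2e-v}M(G)^{v-e}.$$
   Context: Graphs are finite and simple, with nonempty vertex set. $\hom(H,G)$ is the number of homomorphisms from $H$ to $G$; $e(G)$ is the number of edges of $G$; $\lambda(G)$ is the spectral radius of its adjacency matrix. For a real $n\times n$ matrix $A$ and $1\le p,r\le\infty$, $\|A\|_{p\to r}:=\sup_{x\neq0}\|Ax\|_r/\|x\|_p$. Operator-norm Sidorenko certificate: with $s_H:=\frac{2e}{v}$ and $s_H':=\frac{2e}{2e-v}$, $H$ satisfies the certificate if for every graph $G$ with adjacency matrix $A=A(G)$ one has $\hom(H,G)\ge\|A\|_{s_H'\to s_H}^{\,e}$. *)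

theory Defs
  imports
    "HOL-Library.Extended_Real"
    "HOL-Library.FuncSet"
    "Jordan_Normal_Form.Spectral_Radius"
begin

record 'a graph =
  verts :: "'a set"
  edges :: "'a set set"

definition simple_graph :: "'a graph \<Rightarrow> bool" where
  "simple_graph G \<longleftrightarrow>
     finite (verts G) \<and> verts G \<noteq> {} \<and> (\<forall>d \<in> edges G. d \<subseteq> verts G \<and> card d = 2)"

definition num_verts :: "'a graph \<Rightarrow> nat" where
  "num_verts G = card (verts G)"

definition num_edges :: "'a graph \<Rightarrow> nat" where
  "num_edges G = card (edges G)"

definition bipartite :: "'a graph \<Rightarrow> bool" where
  "bipartite G \<longleftrightarrow> (\<exists>X Y. X \<union> Y = verts G \<and> X \<inter> Y = {} \<and>
     (\<forall>d \<in> edges G. \<exists>x \<in> X. \<exists>y \<in> Y. d = {x, y}))"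

text \<open>Homomorphisms are taken in the extensional function space, so that maps differing only
  outside the vertex set of \<open>H\<close> are not counted separately.\<close>

definition homs :: "'a graph \<Rightarrow> 'b graph \<Rightarrow> ('a \<Rightarrow> 'b) set" where
  "homs H G = {f \<in> verts H \<rightarrow>\<^sub>E verts G.
     \<forall>x y. {x, y} \<in> edges H \<longrightarrow> {f x, f y} \<in> edges G}"

definition hom_count :: "'a graph \<Rightarrow> 'b graph \<Rightarrow> nat" where
  "hom_count H G = card (homs H G)"

text \<open>The rows and columns of the adjacency matrix follow an arbitrary but fixed enumeration of
  the vertices; the operator norms and the spectral radius do not depend on its choice.\<close>

definition vertex_list :: "'a graph \<Rightarrow> 'a list" where
  "vertex_list G = (SOME vs. distinct vs \<and> set vs = verts G)"

definition adj_matrix :: "'a graph \<Rightarrow> real mat" where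
  "adj_matrix G = mat (num_verts G) (num_verts G)
     (\<lambda>(i, j). if {vertex_list G ! i, vertex_list G ! j} \<in> edges G then 1 else 0)"

definition graph_spectral_radius :: "'a graph \<Rightarrow> real" where
  "graph_spectral_radius G = spectral_radius (map_mat complex_of_real (adj_matrix G))"

text \<open>The exponent \<open>p\<close> ranges over \<open>1 \<le> p \<le> \<infinity>\<close>, and vectors have positive dimension.\<close>

definition p_norm :: "ereal \<Rightarrow> real vec \<Rightarrow> real" where
  "p_norm p x =
     (if p = \<infinity> then Max {\<bar>x $ i\<bar> | i. i < dim_vec x}
      else (\<Sum>i<dim_vec x. \<bar>x $ i\<bar> powr real_of_ereal p) powr (1 / real_of_ereal p))"

text \<open>The supremum is a real one; for \<open>1 \<le> p, r \<le> \<infinity>\<close> the set of quotients is bounded.\<close>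

definition op_norm :: "ereal \<Rightarrow> ereal \<Rightarrow> real mat \<Rightarrow> real" where
  "op_norm p r A =
     (SUP x \<in> carrier_vec (dim_col A) - {0\<^sub>v (dim_col A)}. p_norm r (A *\<^sub>v x) / p_norm p x)"

definition sid_exp :: "'a graph \<Rightarrow> ereal" where
  "sid_exp H = ereal (2 * real (num_edges H)) / ereal (real (num_verts H))"

text \<open>Division in \<^typ>\<open>ereal\<close> makes the dual exponent infinite when \<open>2e = v > 0\<close>. The exponents
  lie in the range \<open>[1, \<infinity>]\<close> exactly when \<open>v \<le> 2e\<close>.\<close>

definition sid_exp_dual :: "'a graph \<Rightarrow> ereal" where
  "sid_exp_dual H =
     ereal (2 * real (num_edges H)) / ereal (2 * real (num_edges H) - real (num_verts H))"

text \<open>Since a quantified type is not available inside a definition, the target graphs have natural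
  numbers as vertices; every finite graph is isomorphic to one of these.\<close>

definition op_norm_certificate :: "'a graph \<Rightarrow> bool" where
  "op_norm_certificate H \<longleftrightarrow> (\<forall>G :: nat graph. simple_graph G \<longrightarrow>
     real (hom_count H G) \<ge> op_norm (sid_exp_dual H) (sid_exp H) (adj_matrix G) ^ num_edges H)"

end

theory Submission
  imports Defs "HOL-Analysis.Convex"
begin

text \<open>For conjugate exponents \<open>p\<close> and \<open>r\<close> with \<open>p \<le> 2\<close>, the bound on a 0-1 matrix \<open>A\<close> as an operator
  on \<open>\<ell>\<^sup>2\<close> interpolates between its norms \<open>\<ell>\<^sup>p \<rightarrow> \<ell>\<^sup>r\<close> and \<open>\<ell>\<^sup>\<infinity> \<rightarrow> \<ell>\<^sup>1\<close>, the latter being the number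
  \<open>M\<close> of ones. Concretely, let \<open>x\<close> be the entrywise modulus of a unit eigenvector for an eigenvalue
  of modulus \<open>\<lambda>\<close>, so that \<open>\<lambda>\<close> is at most the sum of \<open>x i * x j\<close> over the positions of the ones.
  The power mean inequality with exponent \<open>2 / p\<close> and the test vector \<open>x i powr (2 / p)\<close>, whose
  \<open>p\<close>-norm is 1, give \<open>\<lambda> powr (2 / p) \<le> M powr (2 / p - 1) * N\<close> for the operator norm \<open>N\<close>.
  For the exponents of \<open>H\<close> one has \<open>2 / p = (2 * e - v) / e\<close>, and the \<open>e\<close>-th power of this
  inequality combines with the certificate.\<close>

section \<open>Hoelder and power mean inequalities for finite sums\<close>

text \<open>Young's inequality is applied termwise after both families are scaled to norm 1. The
  scaling divides by the two sums of powers, so the case where one of them vanishes is treated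
  first; there one family is identically zero.\<close>

lemma Holder_inequality_sum:
  fixes f g :: "'a \<Rightarrow> real"
  assumes fin: "finite I" and p: "p > 1" and r: "r > 1" and pr: "1 / p + 1 / r = 1"
    and f: "\<And>i. i \<in> I \<Longrightarrow> f i \<ge> 0" and g: "\<And>i. i \<in> I \<Longrightarrow> g i \<ge> 0"
  shows "(\<Sum>i\<in>I. f i * g i) \<le>
    (\<Sum>i\<in>I. f i powr p) powr (1 / p) * (\<Sum>i\<in>I. g i powr r) powr (1 / r)"
proof (cases "(\<Sum>i\<in>I. f i powr p) = 0 \<or> (\<Sum>i\<in>I. g i powr r) = 0")
  case True
  then have "(\<forall>i\<in>I. f i = 0) \<or> (\<forall>i\<in>I. g i = 0)"
    using fin by (auto simp: sum_nonneg_eq_0_iff)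
  then have "(\<Sum>i\<in>I. f i * g i) = 0"
    by (auto intro!: sum.neutral)
  then show ?thesis by simp
next
  case False
  define F where "F = (\<Sum>i\<in>I. f i powr p)"
  define K where "K = (\<Sum>i\<in>I. g i powr r)"
  have "F \<ge> 0" "K \<ge> 0" unfolding F_def K_def by (auto intro: sum_nonneg)
  with False have F: "F > 0" and K: "K > 0" by (auto simp: F_def K_def)
  define a where "a = F powr (1 / p)"
  define b where "b = K powr (1 / r)"
  have a: "a > 0" and b: "b > 0" using F K by (auto simp: a_def b_def)
  have ap: "a powr p = F" using F p by (simp add: a_def powr_powr)
  have br: "b powr r = K" using K r by (simp add: b_def powr_powr)
  have "(\<Sum>i\<in>I. (f i / a) * (g i / b)) \<le>
      (\<Sum>i\<in>I. (f i / a) powr p / p + (g i / b) powr r / r)"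
    using f g a b p r pr by (intro sum_mono Youngs_inequality) auto
  also have "\<dots> = (\<Sum>i\<in>I. f i powr p / F / p + g i powr r / K / r)"
    using f g a b by (intro sum.cong) (auto simp: powr_divide ap br)
  also have "\<dots> = F / F / p + K / K / r"
    unfolding sum.distrib F_def K_def by (simp only: sum_divide_distrib)
  also have "\<dots> = 1" using F K pr by simp
  finally have "(\<Sum>i\<in>I. f i * g i / (a * b)) \<le> 1" by simp
  then have "(\<Sum>i\<in>I. f i * g i) / (a * b) \<le> 1"
    by (simp add: sum_divide_distrib)
  then show ?thesis
    using a b by (simp add: divide_le_eq a_def b_def F_def K_def)
qed

text \<open>This is Hoelder's inequality against the constant function 1, raised to the power
  \<open>p\<close>; the constant contributes the factor \<open>card I\<close>.\<close>

lemma power_mean_sum: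
  fixes f :: "'a \<Rightarrow> real"
  assumes fin: "finite I" and p: "p \<ge> 1" and f: "\<And>i. i \<in> I \<Longrightarrow> f i \<ge> 0"
  shows "(\<Sum>i\<in>I. f i) powr p \<le> real (card I) powr (p - 1) * (\<Sum>i\<in>I. f i powr p)"
proof (cases "p = 1 \<or> I = {}")
  case True
  then show ?thesis using f fin by (auto simp: sum_nonneg)
next
  case False
  with p have p1: "p > 1" by simp
  \<comment> \<open>The conjugate exponent of \<open>p\<close>; it is undefined at
    \<open>p = 1\<close>, where the claim is trivial.\<close>
  define r where "r = p / (p - 1)"
  have r: "r > 1" "1 / p + 1 / r = 1" "1 / r * p = p - 1"
    using p1 by (auto simp: r_def field_simps)
  have "(\<Sum>i\<in>I. f i * 1) \<le>
      (\<Sum>i\<in>I. f i powr p) powr (1 / p) * (\<Sum>i\<in>I. 1 powr r) powr (1 / r)"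
    using fin p1 r f by (intro Holder_inequality_sum) auto
  then have "(\<Sum>i\<in>I. f i) powr p \<le>
      ((\<Sum>i\<in>I. f i powr p) powr (1 / p) * real (card I) powr (1 / r)) powr p"
    using p1 f by (intro powr_mono2) (auto intro: sum_nonneg)
  also have "\<dots> = (\<Sum>i\<in>I. f i powr p) * real (card I) powr (p - 1)"
    using p1 r(3) by (simp add: powr_mult powr_powr sum_nonneg)
  finally show ?thesis by (simp add: mult.commute)
qed

section \<open>Operator norms between spaces with finite exponents\<close>

lemma p_norm_ereal:
  "p_norm (ereal p) x = (\<Sum>i<dim_vec x. \<bar>x $ i\<bar> powr p) powr (1 / p)"
  by (simp add: p_norm_def)

lemma p_norm_nonneg: "p_norm (ereal p) x \<ge> 0"
  by (simp add: p_norm_ereal)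

lemma abs_index_le_p_norm:
  assumes "p > 0" and "i < dim_vec x"
  shows "\<bar>x $ i\<bar> \<le> p_norm (ereal p) x"
proof -
  have "\<bar>x $ i\<bar> powr p \<le> (\<Sum>i<dim_vec x. \<bar>x $ i\<bar> powr p)"
    using assms(2) by (intro member_le_sum) auto
  then have "(\<bar>x $ i\<bar> powr p) powr (1 / p) \<le> p_norm (ereal p) x"
    unfolding p_norm_ereal using assms(1) by (intro powr_mono2) auto
  then show ?thesis using assms(1) by (simp add: powr_powr)
qed

text \<open>A crude constant is enough: its only purpose is to show that the real supremum in
  \<open>op_norm\<close> is taken over a bounded set.\<close>

lemma p_norm_mult_mat_vec_bounded:
  assumes p: "p > 0" and r: "r > 0"
  shows "\<exists>C. \<forall>x \<in> carrier_vec (dim_col A).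
    p_norm (ereal r) (A *\<^sub>v x) \<le> C * p_norm (ereal p) x"
proof (intro exI ballI)
  define B where "B = (\<Sum>i<dim_row A. \<Sum>j<dim_col A. \<bar>A $$ (i, j)\<bar>)"
  fix x :: "real vec" assume x: "x \<in> carrier_vec (dim_col A)"
  let ?N = "p_norm (ereal p) x"
  have N: "?N \<ge> 0" by (rule p_norm_nonneg)
  have B: "B \<ge> 0" by (auto simp: B_def intro!: sum_nonneg)
  have entry: "\<bar>(A *\<^sub>v x) $ i\<bar> \<le> B * ?N" if i: "i < dim_row A" for i
  proof -
    have "(A *\<^sub>v x) $ i = (\<Sum>j<dim_col A. A $$ (i, j) * x $ j)"
      using i x by (simp add: scalar_prod_def lessThan_atLeast0)
    also have "\<bar>\<dots>\<bar> \<le> (\<Sum>j<dim_col A. \<bar>A $$ (i, j) * x $ j\<bar>)" by (rule sum_abs)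
    also have "\<dots> \<le> (\<Sum>j<dim_col A. \<bar>A $$ (i, j)\<bar> * ?N)"
      using x p unfolding abs_mult
      by (intro sum_mono mult_left_mono abs_index_le_p_norm) auto
    also have "\<dots> = (\<Sum>j<dim_col A. \<bar>A $$ (i, j)\<bar>) * ?N"
      by (simp add: sum_distrib_right)
    also have "\<dots> \<le> B * ?N" unfolding B_def
      using i N by (intro mult_right_mono member_le_sum) (auto intro: sum_nonneg)
    finally show ?thesis .
  qed
  have "(\<Sum>i<dim_row A. \<bar>(A *\<^sub>v x) $ i\<bar> powr r) \<le> (\<Sum>i<dim_row A. (B * ?N) powr r)"
    using entry r by (intro sum_mono powr_mono2) auto
  then have "p_norm (ereal r) (A *\<^sub>v x) \<le> (real (dim_row A) * (B * ?N) powr r) powr (1 / r)"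
    unfolding p_norm_ereal using r by (intro powr_mono2) (auto intro: sum_nonneg)
  also have "\<dots> = real (dim_row A) powr (1 / r) * (B * ?N)"
    using r B N by (simp add: powr_mult powr_powr)
  finally show "p_norm (ereal r) (A *\<^sub>v x) \<le> (real (dim_row A) powr (1 / r) * B) * ?N"
    by (simp add: mult.assoc)
qed

lemma p_norm_mult_mat_vec_le_op_norm:
  assumes p: "p > 0" and r: "r > 0" and x: "x \<in> carrier_vec (dim_col A)"
  shows "p_norm (ereal r) (A *\<^sub>v x) \<le> op_norm (ereal p) (ereal r) A * p_norm (ereal p) x"
proof -
  obtain C where C: "\<And>x. x \<in> carrier_vec (dim_col A) \<Longrightarrow>
      p_norm (ereal r) (A *\<^sub>v x) \<le> C * p_norm (ereal p) x"
    using p_norm_mult_mat_vec_bounded[OF p r] by blast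
  show ?thesis
  \<comment> \<open>A vector of norm zero gives no information through its quotient, but the crude
    bound forces its image to have norm zero too.\<close>
  proof (cases "p_norm (ereal p) x = 0")
    case True
    then show ?thesis using C[OF x] by simp
  next
    case False
    then have pos: "p_norm (ereal p) x > 0" using p_norm_nonneg[of p x] by simp
    have x0: "x \<noteq> 0\<^sub>v (dim_col A)" using False by (auto simp: p_norm_ereal)
    have "p_norm (ereal r) (A *\<^sub>v x) / p_norm (ereal p) x \<le> op_norm (ereal p) (ereal r) A"
      unfolding op_norm_def
    proof (rule cSUP_upper)
      \<comment> \<open>The maximum with 0 covers vectors of norm zero, whose quotient is 0 by the
        convention on division.\<close>
      have "p_norm (ereal r) (A *\<^sub>v y) / p_norm (ereal p) y \<le> max C 0"
        if "y \<in> carrier_vec (dim_col A)" for y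
      proof (cases "p_norm (ereal p) y = 0")
        case False
        then have "p_norm (ereal p) y > 0" using p_norm_nonneg[of p y] by simp
        then show ?thesis using C[OF that] by (simp add: divide_le_eq le_max_iff_disj)
      qed simp
      then show "bdd_above ((\<lambda>x. p_norm (ereal r) (A *\<^sub>v x) / p_norm (ereal p) x) `
          (carrier_vec (dim_col A) - {0\<^sub>v (dim_col A)}))"
        by (intro bdd_aboveI2[where M = "max C 0"]) auto
    qed (use x x0 in auto)
    then show ?thesis using pos by (simp add: divide_le_eq)
  qed
qed

text \<open>Conjugacy of the exponents lets Hoelder's inequality pair \<open>y\<close> in the
  \<open>p\<close>-norm with \<open>A *\<^sub>v x\<close> in the \<open>r\<close>-norm, so both
  vectors are measured in the same norm.\<close>

lemma bilinear_form_le_op_norm: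
  assumes p: "p > 1" and r: "r > 1" and pr: "1 / p + 1 / r = 1"
    and x: "x \<in> carrier_vec (dim_col A)" and y: "y \<in> carrier_vec (dim_row A)"
  shows "y \<bullet> (A *\<^sub>v x) \<le>
    op_norm (ereal p) (ereal r) A * p_norm (ereal p) x * p_norm (ereal p) y"
proof -
  have "y \<bullet> (A *\<^sub>v x) \<le> (\<Sum>i<dim_row A. \<bar>y $ i\<bar> * \<bar>(A *\<^sub>v x) $ i\<bar>)"
    unfolding scalar_prod_def lessThan_atLeast0 abs_mult[symmetric]
    by (simp only: dim_mult_mat_vec) (intro sum_mono abs_ge_self)
  also have "\<dots> \<le> p_norm (ereal p) y * p_norm (ereal r) (A *\<^sub>v x)"
    using Holder_inequality_sum[OF _ p r pr, of "{..<dim_row A}" "\<lambda>i. \<bar>y $ i\<bar>" "\<lambda>i. \<bar>(A *\<^sub>v x) $ i\<bar>"] y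
    by (simp add: p_norm_ereal)
  also have "\<dots> \<le> p_norm (ereal p) y * (op_norm (ereal p) (ereal r) A * p_norm (ereal p) x)"
    using p r x by (intro mult_left_mono p_norm_mult_mat_vec_le_op_norm p_norm_nonneg) auto
  finally show ?thesis by (simp add: mult_ac)
qed

section \<open>Spectral radius and operator norm\<close>

text \<open>An eigenvector \<open>z\<close> for an eigenvalue of maximal modulus may be complex.
  Taking moduli in each row of the eigenvalue equation leaves an inequality with the same matrix,
  since its entries are nonnegative.\<close>

lemma spectral_radius_le_quadratic_form:
  fixes A :: "real mat"
  assumes A: "A \<in> carrier_mat n n" and n: "n > 0"
    and nonneg: "\<And>i j. i < n \<Longrightarrow> j < n \<Longrightarrow> A $$ (i, j) \<ge> 0"
  obtains x :: "nat \<Rightarrow> real" where "\<And>i. x i \<ge> 0" and "(\<Sum>i<n. (x i)\<^sup>2) = 1"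
    and "spectral_radius (map_mat complex_of_real A) \<le>
      (\<Sum>i<n. \<Sum>j<n. A $$ (i, j) * (x i * x j))"
proof -
  let ?B = "map_mat complex_of_real A"
  let ?\<rho> = "spectral_radius ?B"
  have B: "?B \<in> carrier_mat n n" using A by simp
  obtain \<mu> where \<mu>: "eigenvalue ?B \<mu>" "?\<rho> = norm \<mu>"
    using spectral_radius_mem_max(1)[OF B n] by (auto simp: spectrum_def)
  obtain z where z: "z \<in> carrier_vec n" "z \<noteq> 0\<^sub>v n" "?B *\<^sub>v z = \<mu> \<cdot>\<^sub>v z"
    using \<mu>(1) A by (auto simp: eigenvalue_def eigenvector_def)
  define s where "s = (\<Sum>i<n. (norm (z $ i))\<^sup>2)"
  define x where "x i = norm (z $ i) / sqrt s" for i
  obtain k where k: "k < n" "z $ k \<noteq> 0" using z(1,2) by (metis eq_vecI carrier_vecD index_zero_vec)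
  have s: "s > 0" unfolding s_def
    by (rule sum_pos2[of _ k]) (use k in auto)
  have row: "?\<rho> * norm (z $ i) \<le> (\<Sum>j<n. A $$ (i, j) * norm (z $ j))" if i: "i < n" for i
  proof -
    have "\<mu> * z $ i = (?B *\<^sub>v z) $ i" using z(1) i unfolding z(3) by simp
    also have "\<dots> = (\<Sum>j<n. complex_of_real (A $$ (i, j)) * z $ j)"
      using A z(1) i by (simp add: scalar_prod_def lessThan_atLeast0)
    finally have "?\<rho> * norm (z $ i) = norm (\<Sum>j<n. complex_of_real (A $$ (i, j)) * z $ j)"
      by (metis \<mu>(2) norm_mult)
    also have "\<dots> \<le> (\<Sum>j<n. norm (complex_of_real (A $$ (i, j)) * z $ j))" by (rule norm_sum)
    also have "\<dots> = (\<Sum>j<n. A $$ (i, j) * norm (z $ j))"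
      using nonneg i by (intro sum.cong) (auto simp: norm_mult)
    finally show ?thesis .
  qed
  have xx: "x i * x j = norm (z $ i) * norm (z $ j) / s" for i j
    using s by (simp add: x_def)
  \<comment> \<open>Weighting row \<open>i\<close> by the modulus of \<open>z $ i\<close> and
    summing produces the quadratic form; dividing by \<open>s\<close> normalises it.\<close>
  have "?\<rho> * s = (\<Sum>i<n. norm (z $ i) * (?\<rho> * norm (z $ i)))"
    by (simp add: s_def sum_distrib_left power2_eq_square mult_ac)
  also have "\<dots> \<le> (\<Sum>i<n. norm (z $ i) * (\<Sum>j<n. A $$ (i, j) * norm (z $ j)))"
    using row by (intro sum_mono mult_left_mono) auto
  also have "\<dots> = (\<Sum>i<n. \<Sum>j<n. A $$ (i, j) * (x i * x j)) * s"
    using s by (simp add: xx sum_distrib_left sum_distrib_right mult_ac)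
  finally have "?\<rho> \<le> (\<Sum>i<n. \<Sum>j<n. A $$ (i, j) * (x i * x j))" using s by simp
  moreover have "(\<Sum>i<n. (x i)\<^sup>2) = 1"
    using s by (simp add: x_def power_divide s_def[symmetric] flip: sum_divide_distrib)
  ultimately show thesis using s by (intro that[of x]) (auto simp: x_def)
qed

lemma spectral_radius_le_op_norm:
  fixes A :: "real mat"
  assumes A: "A \<in> carrier_mat n n" and n: "n > 0"
    and A01: "\<And>i j. i < n \<Longrightarrow> j < n \<Longrightarrow> A $$ (i, j) \<in> {0, 1}"
    and p: "1 < p" "p \<le> 2" and r: "r > 1" and pr: "1 / p + 1 / r = 1"
  shows "spectral_radius (map_mat complex_of_real A) powr (2 / p) \<le>
    real (card {(i, j). i < n \<and> j < n \<and> A $$ (i, j) = 1}) powr (2 / p - 1)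
      * op_norm (ereal p) (ereal r) A"
proof -
  let ?\<rho> = "spectral_radius (map_mat complex_of_real A)"
  let ?q = "2 / p"
  define S where "S = {(i, j). i < n \<and> j < n \<and> A $$ (i, j) = 1}"
  have "S \<subseteq> {..<n} \<times> {..<n}" by (auto simp: S_def)
  then have finS: "finite S" by (rule finite_subset) simp
  \<comment> \<open>Passing to an unweighted sum over the support is what makes the number of ones
    appear as the cardinality in the power mean inequality.\<close>
  have sumS: "(\<Sum>i<n. \<Sum>j<n. A $$ (i, j) * h i j) = (\<Sum>(i, j)\<in>S. h i j)" for h :: "nat \<Rightarrow> nat \<Rightarrow> real"
  proof -
    have "(\<Sum>i<n. \<Sum>j<n. A $$ (i, j) * h i j) = (\<Sum>(i, j)\<in>{..<n} \<times> {..<n}. A $$ (i, j) * h i j)"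
      by (simp add: sum.cartesian_product)
    also have "\<dots> = (\<Sum>(i, j)\<in>S. A $$ (i, j) * h i j)"
      proof (rule sum.mono_neutral_right)
      show "\<forall>z \<in> {..<n} \<times> {..<n} - S. (case z of (i, j) \<Rightarrow> A $$ (i, j) * h i j) = 0"
      proof
        fix z assume z: "z \<in> {..<n} \<times> {..<n} - S"
        obtain i j where ij: "z = (i, j)" by (cases z)
        then have "i < n" "j < n" "A $$ (i, j) \<noteq> 1" using z by (auto simp: S_def)
        then have "A $$ (i, j) = 0" using A01 by blast
        then show "(case z of (i, j) \<Rightarrow> A $$ (i, j) * h i j) = 0" by (simp add: ij)
      qed
    qed (auto simp: S_def)
    also have "\<dots> = (\<Sum>(i, j)\<in>S. h i j)" by (intro sum.cong) (auto simp: S_def)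
    finally show ?thesis .
  qed
  have nonneg: "A $$ (i, j) \<ge> 0" if "i < n" "j < n" for i j using A01[OF that] by auto
  obtain x where x: "\<And>i. x i \<ge> 0" "(\<Sum>i<n. (x i)\<^sup>2) = 1"
    "?\<rho> \<le> (\<Sum>i<n. \<Sum>j<n. A $$ (i, j) * (x i * x j))"
    by (rule spectral_radius_le_quadratic_form[OF A n nonneg]) (assumption | rule that)+
  have \<rho>0: "?\<rho> \<ge> 0"
    using spectral_radius_mem_max(1)[of "map_mat complex_of_real A" n] A n by auto
  define y where "y = vec n (\<lambda>i. x i powr ?q)"
  have "(\<Sum>i<n. \<bar>y $ i\<bar> powr p) = (\<Sum>i<n. (x i)\<^sup>2)"
    using p x(1) by (intro sum.cong) (auto simp: y_def powr_powr)
  then have y1: "p_norm (ereal p) y = 1" using x(2) by (simp add: p_norm_ereal y_def)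
  have "?\<rho> powr ?q \<le> (\<Sum>(i, j)\<in>S. x i * x j) powr ?q"
    using x(3) \<rho>0 p by (intro powr_mono2) (auto simp: sumS)
  also have "\<dots> \<le> real (card S) powr (?q - 1) * (\<Sum>(i, j)\<in>S. (x i * x j) powr ?q)"
    using power_mean_sum[OF finS, of ?q "\<lambda>(i, j). x i * x j"] p x(1)
    by (auto simp: case_prod_beta)
  \<comment> \<open>The power of a product factors, so the powered sum is again a bilinear form in
    \<open>A\<close>, now evaluated at \<open>y\<close>.\<close>
  also have "(\<Sum>(i, j)\<in>S. (x i * x j) powr ?q) = (\<Sum>(i, j)\<in>S. x i powr ?q * x j powr ?q)"
    using x(1) by (simp add: powr_mult)
  also have "\<dots> = y \<bullet> (A *\<^sub>v y)"
    using A unfolding sumS[symmetric]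
    by (simp add: y_def scalar_prod_def lessThan_atLeast0 sum_distrib_left mult_ac)
  also have "real (card S) powr (?q - 1) * (y \<bullet> (A *\<^sub>v y)) \<le>
      real (card S) powr (?q - 1) * op_norm (ereal p) (ereal r) A"
    using bilinear_form_le_op_norm[OF p(1) r pr, of y A y] A y1
    by (intro mult_left_mono) (auto simp: y_def)
  finally show ?thesis by (simp add: S_def)
qed

section \<open>Adjacency matrices and edge counts\<close>

lemma vertex_list:
  assumes "finite (verts G)"
  shows "distinct (vertex_list G)" and "set (vertex_list G) = verts G"
    and "length (vertex_list G) = num_verts G"
proof -
  have "\<exists>vs. distinct vs \<and> set vs = verts G"
    using finite_distinct_list[OF assms] by blast
  then have *: "distinct (vertex_list G) \<and> set (vertex_list G) = verts G"
    unfolding vertex_list_def by (rule someI_ex)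
  then show "distinct (vertex_list G)" and "set (vertex_list G) = verts G" by auto
  then show "length (vertex_list G) = num_verts G"
    by (metis distinct_card num_verts_def)
qed

lemma vertex_list_bij:
  assumes "finite (verts G)"
  shows "bij_betw ((!) (vertex_list G)) {..<num_verts G} (verts G)"
  using bij_betw_nth[OF vertex_list(1)[OF assms]] vertex_list[OF assms] by auto

text \<open>The enumeration of the vertices embeds the positions of the ones into ordered pairs of
  adjacent vertices, and each edge has at most two orderings.\<close>

lemma card_adj_matrix_support:
  assumes G: "simple_graph G"
  shows "card {(i, j). i < num_verts G \<and> j < num_verts G \<and> adj_matrix G $$ (i, j) = 1}
    \<le> 2 * num_edges G" (is "card ?S \<le> _")
proof -
  have fin: "finite (verts G)" and e2: "\<And>d. d \<in> edges G \<Longrightarrow> d \<subseteq> verts G \<and> card d = 2"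
    using G by (auto simp: simple_graph_def)
  have finE: "finite (edges G)"
    by (rule finite_subset[of _ "Pow (verts G)"]) (use e2 fin in auto)
  let ?v = "(!) (vertex_list G)"
  let ?P = "\<lambda>d. {(u, w). {u, w} = d}"
  have two: "finite (?P d) \<and> card (?P d) \<le> 2" if "d \<in> edges G" for d
  proof -
    have "card d = 2" using e2[OF that] by simp
    then obtain a b where "d = {a, b}" by (auto simp: card_2_iff)
    then have sub: "?P d \<subseteq> {(a, b), (b, a)}" by (auto simp: doubleton_eq_iff)
    have "card (?P d) \<le> card {(a, b), (b, a)}" by (rule card_mono[OF _ sub]) simp
    also have "\<dots> \<le> 2" by (rule card_insert_le_m1) simp_all
    finally show ?thesis using finite_subset[OF sub] by simp
  qed
  have inj: "inj_on ?v {..<num_verts G}" using vertex_list_bij[OF fin] by (auto simp: bij_betw_def)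
  have "inj_on (map_prod ?v ?v) ({..<num_verts G} \<times> {..<num_verts G})"
    using inj by (rule map_prod_inj_on) (rule inj)
  then have "inj_on (map_prod ?v ?v) ?S" by (rule inj_on_subset) auto
  moreover have "map_prod ?v ?v ` ?S \<subseteq> (\<Union>d\<in>edges G. ?P d)"
    by (auto simp: adj_matrix_def split: if_splits)
  moreover have "finite (\<Union>d\<in>edges G. ?P d)" using finE two by blast
  ultimately have "card ?S \<le> card (\<Union>d\<in>edges G. ?P d)" by (rule card_inj_on_le)
  also have "\<dots> \<le> (\<Sum>d\<in>edges G. card (?P d))" by (rule card_UN_le[OF finE])
  also have "\<dots> \<le> (\<Sum>d\<in>edges G. 2)" using two by (intro sum_mono) auto
  finally show ?thesis by (simp add: num_edges_def)
qed

section \<open>Transfer of the certificate to arbitrary vertex types\<close>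

text \<open>Composition with \<open>f\<close> embeds the homomorphisms into \<open>G'\<close> into
  those into \<open>G\<close>. The composite is restricted to \<open>verts H\<close> to stay in the
  extensional function space.\<close>

lemma hom_count_le_of_injective:
  assumes fin: "finite (homs H G)" and f: "inj_on f (verts G')" "f ` verts G' \<subseteq> verts G"
    and H: "\<And>x y. {x, y} \<in> edges H \<Longrightarrow> x \<in> verts H \<and> y \<in> verts H"
    and E: "\<And>x y. {x, y} \<in> edges G' \<Longrightarrow> {f x, f y} \<in> edges G"
  shows "hom_count H G' \<le> hom_count H G"
  unfolding hom_count_def
proof (rule card_inj_on_le[OF _ _ fin])
  let ?c = "\<lambda>h. restrict (f \<circ> h) (verts H)"
  show "inj_on ?c (homs H G')"
  proof (rule inj_onI)
    fix h k assume hk: "h \<in> homs H G'" "k \<in> homs H G'" "?c h = ?c k"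
    show "h = k"
    proof (rule PiE_ext[of _ "verts H" "\<lambda>_. verts G'"])
      fix x assume x: "x \<in> verts H"
      then have "f (h x) = f (k x)" using hk(3) by (metis comp_apply restrict_apply')
      moreover have "h x \<in> verts G'" "k x \<in> verts G'" using hk(1,2) x by (auto simp: homs_def)
      ultimately show "h x = k x" using f(1) by (auto dest: inj_onD)
    qed (use hk in \<open>auto simp: homs_def\<close>)
  qed
  show "?c ` homs H G' \<subseteq> homs H G"
    using f(2) H E by (fastforce simp: homs_def)
qed

text \<open>The certificate only speaks about graphs on natural numbers. As \<^const>\<open>vertex_list\<close> depends
  on the vertex set alone, the copy can be labelled so that its adjacency matrix is literally the
  same.\<close>

lemma exists_nat_graph_same_adj_matrix:
  assumes G: "simple_graph G"
  obtains G' :: "nat graph" and f where "simple_graph G'" and "adj_matrix G' = adj_matrix G"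
    and "inj_on f (verts G')" and "f ` verts G' \<subseteq> verts G"
    and "\<And>x y. {x, y} \<in> edges G' \<Longrightarrow> {f x, f y} \<in> edges G"
proof -
  have fin: "finite (verts G)" and ne: "verts G \<noteq> {}"
    and e2: "\<And>d. d \<in> edges G \<Longrightarrow> card d = 2"
    using G by (auto simp: simple_graph_def)
  define n where "n = num_verts G"
  have n: "n > 0" using fin ne by (simp add: n_def num_verts_def card_gt_0_iff)
  \<comment> \<open>The edges of \<open>G'\<close> are defined through \<open>f\<close>, and
    \<open>f\<close> through the vertex list of \<open>G'\<close>. Taking the list from the edgeless
    graph on the same vertices avoids this circularity.\<close>
  define vs where "vs = vertex_list (\<lparr>verts = {..<n}, edges = {}\<rparr> :: nat graph)"
  \<comment> \<open>Vertices at equal positions in the two lists correspond, so the matrices agree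
    entry by entry.\<close>
  define f where "f = (!) (vertex_list G) \<circ> inv_into {..<n} ((!) vs)"
  define G' where "G' = \<lparr>verts = {..<n}, edges = {d. d \<subseteq> {..<n} \<and> f ` d \<in> edges G}\<rparr>"
  have vs: "vertex_list G' = vs" by (simp add: vertex_list_def vs_def G'_def)
  have n': "num_verts G' = n" by (simp add: G'_def num_verts_def)
  have bvs: "bij_betw ((!) vs) {..<n} {..<n}"
    using vertex_list_bij[of G'] vs n' by (simp add: G'_def)
  have bf: "bij_betw f {..<n} (verts G)" unfolding f_def
    using bij_betw_inv_into[OF bvs] vertex_list_bij[OF fin, folded n_def]
    by (rule bij_betw_trans)
  have fvs: "f (vs ! i) = vertex_list G ! i" if "i < n" for i
    using that bvs by (simp add: f_def bij_betw_def)
  have edge: "{vs ! i, vs ! j} \<in> edges G' \<longleftrightarrow> {vertex_list G ! i, vertex_list G ! j} \<in> edges G"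
    if "i < n" "j < n" for i j
    using that bij_betwE[OF bvs] by (simp add: G'_def fvs)
  show thesis
  proof (rule that[of G' f])
    show "simple_graph G'" unfolding simple_graph_def
    proof (intro conjI ballI)
      fix d assume d: "d \<in> edges G'"
      then have "inj_on f d" using bf by (auto simp: G'_def bij_betw_def intro: inj_on_subset)
      then show "card d = 2" using d e2 by (metis (mono_tags, lifting) G'_def card_image
            graph.select_convs(2) mem_Collect_eq)
    qed (use n in \<open>auto simp: G'_def\<close>)
    show "adj_matrix G' = adj_matrix G"
      unfolding adj_matrix_def n' vs n_def[symmetric] by (rule eq_matI) (auto simp: edge)
  qed (use bf in \<open>auto simp: G'_def bij_betw_def\<close>)
qed

lemma hom_count_ge_of_certificate:
  assumes H: "simple_graph H" and G: "simple_graph G" and cert: "op_norm_certificate H"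
  shows "op_norm (sid_exp_dual H) (sid_exp H) (adj_matrix G) ^ num_edges H \<le> real (hom_count H G)"
proof -
  obtain G' :: "nat graph" and f where G': "simple_graph G'" "adj_matrix G' = adj_matrix G"
    and f: "inj_on f (verts G')" "f ` verts G' \<subseteq> verts G"
      "\<And>x y. {x, y} \<in> edges G' \<Longrightarrow> {f x, f y} \<in> edges G"
    by (rule exists_nat_graph_same_adj_matrix[OF G]) (rule that)
  have "homs H G \<subseteq> verts H \<rightarrow>\<^sub>E verts G" by (auto simp: homs_def)
  moreover have "finite (verts H \<rightarrow>\<^sub>E verts G)"
    using H G by (auto simp: simple_graph_def intro: finite_PiE)
  ultimately have "finite (homs H G)" by (rule finite_subset)
  then have "hom_count H G' \<le> hom_count H G"
    using f H by (intro hom_count_le_of_injective) (auto simp: simple_graph_def)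
  moreover have "op_norm (sid_exp_dual H) (sid_exp H) (adj_matrix G) ^ num_edges H
      \<le> real (hom_count H G')"
    using cert G' by (auto simp: op_norm_certificate_def)
  ultimately show ?thesis by linarith
qed

section \<open>Exponents of \<open>H\<close> and the final estimate\<close>

theorem lemma2p3:
  fixes H :: "'a graph" and G :: "'b graph" and v e :: nat and M :: real
  assumes "simple_graph H" and "bipartite H"
    and "v = num_verts H" and "e = num_edges H" and "v \<le> e"
    and "op_norm_certificate H"
    and "simple_graph G" and "M = 2 * real (num_edges G)" and "M > 0"
  shows "real (hom_count H G) \<ge>
    graph_spectral_radius G powi (2 * int e - int v) * M powi (int v - int e)"
proof -
  have v: "v > 0" using assms(1,3) by (auto simp: simple_graph_def num_verts_def card_gt_0_iff)
  with \<open>v \<le> e\<close> have e: "e > 0" by simp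
  have n: "num_verts G > 0"
    using assms(7) by (auto simp: simple_graph_def num_verts_def card_gt_0_iff)
  define p r where "p = 2 * real e / (2 * real e - real v)" and "r = 2 * real e / real v"
  \<comment> \<open>Strict positivity keeps the dual exponent finite; \<open>v \<le> e\<close> also
    yields \<open>p \<le> 2\<close> below.\<close>
  have d: "2 * real e - real v > 0" using v \<open>v \<le> e\<close> by linarith
  have p: "1 < p" "p \<le> 2" and r: "r > 1" and pr: "1 / p + 1 / r = 1"
    using v e d \<open>v \<le> e\<close> by (auto simp: p_def r_def field_simps)
  have sid: "sid_exp_dual H = ereal p" "sid_exp H = ereal r"
    using d v assms(3,4) by (auto simp: sid_exp_dual_def sid_exp_def p_def r_def)
  define N where "N = op_norm (ereal p) (ereal r) (adj_matrix G)"
  define \<rho> where "\<rho> = graph_spectral_radius G"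
  define S where "S = {(i, j). i < num_verts G \<and> j < num_verts G \<and> adj_matrix G $$ (i, j) = 1}"
  have A: "adj_matrix G \<in> carrier_mat (num_verts G) (num_verts G)" by (simp add: adj_matrix_def)
  have \<rho>0: "\<rho> \<ge> 0"
    using spectral_radius_mem_max(1)[of "map_mat complex_of_real (adj_matrix G)" "num_verts G"] A n
    by (auto simp: \<rho>_def graph_spectral_radius_def)
  have N0: "N \<ge> 0"
  proof -
    \<comment> \<open>Any vector of positive norm would serve: the norm of its image is nonnegative
      and at most \<open>N\<close> times its own norm.\<close>
    define x :: "real vec" where "x = vec (num_verts G) (\<lambda>_. 1)"
    have x: "x \<in> carrier_vec (num_verts G)" by (simp add: x_def)
    have "1 \<le> p_norm (ereal p) x"
      using abs_index_le_p_norm[of p 0 x] p n by (simp add: x_def)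
    moreover have "0 \<le> N * p_norm (ereal p) x"
      using p_norm_mult_mat_vec_le_op_norm[of p r x "adj_matrix G"] p r A x
        p_norm_nonneg[of r "adj_matrix G *\<^sub>v x"]
      by (simp add: N_def)
    ultimately show ?thesis by (simp add: zero_le_mult_iff)
  qed
  have "\<rho> powr (2 / p) \<le> real (card S) powr (2 / p - 1) * N"
    unfolding \<rho>_def graph_spectral_radius_def S_def N_def
    using A n p r pr by (intro spectral_radius_le_op_norm) (auto simp: adj_matrix_def)
  \<comment> \<open>Since \<open>p \<le> 2\<close>, the exponent is nonnegative, so the number of
    ones can be replaced by its upper bound \<open>M\<close>.\<close>
  also have "\<dots> \<le> M powr (2 / p - 1) * N"
    using card_adj_matrix_support[OF assms(7)] p N0 assms(8)
    by (intro mult_right_mono powr_mono2) (auto simp: S_def)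
  finally have "(\<rho> powr (2 / p)) ^ e \<le> (M powr (2 / p - 1) * N) ^ e"
    by (rule power_mono) simp
  moreover have "(\<rho> powr (2 / p)) ^ e = \<rho> ^ (2 * e - v)"
  \<comment> \<open>Turning real powers into natural ones requires a positive base. For
    \<open>\<rho> = 0\<close> both sides vanish because \<open>e\<close> and
    \<open>2 * e - v\<close> are positive.\<close>
  proof (cases "\<rho> = 0")
    case False
    have "2 / p * real e = real (2 * e - v)"
      using e d \<open>v \<le> e\<close> by (simp add: p_def of_nat_diff)
    then show ?thesis using False \<rho>0 by (simp add: powr_powr flip: powr_realpow)
  qed (use e \<open>v \<le> e\<close> in \<open>simp add: power_0_left\<close>)
  moreover have "(M powr (2 / p - 1)) ^ e = M ^ (e - v)"
  proof -
    have "(2 / p - 1) * real e = real (e - v)"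
      using e d \<open>v \<le> e\<close> by (simp add: p_def of_nat_diff field_simps)
    then show ?thesis using \<open>M > 0\<close> by (simp add: powr_powr flip: powr_realpow)
  qed
  ultimately have "\<rho> ^ (2 * e - v) \<le> M ^ (e - v) * N ^ e"
    by (simp add: power_mult_distrib)
  also have "\<dots> \<le> M ^ (e - v) * real (hom_count H G)"
    using hom_count_ge_of_certificate[OF assms(1,7,6)] \<open>M > 0\<close> assms(4)
    by (intro mult_left_mono) (auto simp: sid N_def)
  finally have "\<rho> ^ (2 * e - v) / M ^ (e - v) \<le> real (hom_count H G)"
    using \<open>M > 0\<close> by (simp add: divide_le_eq mult.commute)
  moreover have "\<rho> powi (2 * int e - int v) = \<rho> ^ (2 * e - v)"
    using \<open>v \<le> e\<close> by (simp add: power_int_def nat_diff_distrib nat_mult_distrib)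
  moreover have "M powi (int v - int e) = inverse (M ^ (e - v))"
  proof -
    \<comment> \<open>The exponent of \<open>M\<close> is nonpositive, so its integer power is the
      inverse of a natural power.\<close>
    have "int v - int e = - int (e - v)" using \<open>v \<le> e\<close> by simp
    then show ?thesis by (simp only: power_int_minus power_int_of_nat)
  qed
  ultimately show ?thesis by (simp add: \<rho>_def divide_inverse)
qed

end
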